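(* If $k=\top$ in $\mathcal V$, then the Hausdorff functor $H:\mathcal V\text{-}\mathsf{Cat}\to\mathcal V\text{-}\mathsf{Cat}$ induces (via $X\mapsto HX$ on isomorphism classes) a homomorphism $H:(\mathcal GH,+)\to(\mathcal GH,\times)$ of monoids in the monoidal category $\mathcal V\text{-}\mathsf{CAT}$.
   Context: $\mathcal V$ is a commutative unital quantale: a complete lattice with a commutative, associative operation $\otimes$ with neutral element $k$, such that $\otimes$ preserves arbitrary suprema in each variable; it is assumed that $k>\bot$; $\top$ is the top element. A $\mathcal V$-category $X=(X,a)$ is a set $X$ with $a:X\times X\to\mathcal V$ satisfying $k\le a(x,x)$ and $a(x,y)\otimes a(y,z)\le a(x,z)$. A $\mathcal V$-functor $f:(X,a)\to(Y,b)$ is a map with $a(x,y)\le b(f(x),f(y))$. $\mathcal V\text{-}\mathsf{Cat}$ is the category of small, $\mathcal V\text{-}\mathsf{CAT}$ that of possibly large, $\mathcal V$-categories and $\mathcal V$-functors. $\mathcal V\text{-}\mathsf{CAT}$ is monoidal with $(X,a)\otimes(Y,b)=(X\times Y,a\otimes b)$, $(a\otimes b)((x,y),(x',y'))=a(x,x')\otimes b(y,y')$, and unit $E=(\{*\},k)$. The product $X\times Y$ in $\mathcal V\text{-}\mathsf{Cat}$ has structure $((x,y),(x',y'))\mapsto a(x,x')\wedge b(y,y')$; the coproduct $X+Y$ is the disjoint union with structure $a$ on $X$, $b$ on $Y$, and value $\bot$ between elements of different summands. The Hausdorff functor $H$ sends $X=(X,a)$ to $HX=(PX,h_X)$, with $PX$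 the powerset of $X$ and $h_X(A,B)=\bigwedge_{x\in A}\bigvee_{y\in B}a(x,y)$, and $f$ to $A\mapsto f(A)$. A $\mathcal V$-module $\varphi:X\to Y$ between $(X,a)$ and $(Y,b)$ is a function $\varphi:X\times Y\to\mathcal V$ with $a(x',x)\otimes\varphi(x,y)\le\varphi(x',y)$ and $\varphi(x,y)\otimes b(y,y')\le\varphi(x,y')$. For $A\subseteq X$, $B\subseteq Y$ one has $\tilde H\varphi(A,B)=\bigwedge_{x\in A}\bigvee_{y\in B}\varphi(x,y)$. $\mathcal GH=(\mathcal G,GH)$, where $\mathcal G=\mathrm{ob}(\mathcal V\text{-}\mathsf{Cat})/\!\cong$ is the class of isomorphism classes of $\mathcal V$-categories and $GH(X,Y)=\bigvee_{\varphi:X\to Y}\tilde H\varphi(X,Y)$, the join ranging over all $\mathcal V$-modules $\varphi:X\to Y$. When $k=\top$, $\mathcal GH$ is a monoid in $\mathcal V\text{-}\mathsf{CAT}$ both with the operation $+$ (coproduct; neutral element the empty $\mathcal V$-category) and with $\times$ (product; neutral element the terminal $\mathcal V$-category). *)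

theory Defs
  imports Main "HOL-Library.FuncSet"
begin

section \<open>Quantales\<close>

text \<open>The tensor is written \<open>*\<close>, its neutral element \<open>k\<close> is \<open>1\<close>.\<close>

class comm_unital_quantale = complete_lattice + comm_monoid_mult +
  assumes mult_Sup: "x * Sup A = (SUP y\<in>A. x * y)"
    and bot_less_one: "bot < 1"

section \<open>Categories enriched in a quantale, and their functors and modules\<close>

text \<open>
  The carrier is an arbitrary set over the type parameter, so these are the possibly large
  enriched categories. The values of \<open>hom\<close> outside the carrier are irrelevant.
\<close>

record ('a, 'v) vcat =
  obj :: "'a set"
  hom :: "'a \<Rightarrow> 'a \<Rightarrow> 'v"

definition is_vcat :: "('a, 'v::comm_unital_quantale) vcat \<Rightarrow> bool" where
  "is_vcat X \<longleftrightarrow>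
     (\<forall>x\<in>obj X. 1 \<le> hom X x x) \<and>
     (\<forall>x\<in>obj X. \<forall>y\<in>obj X. \<forall>z\<in>obj X. hom X x y * hom X y z \<le> hom X x z)"

definition is_vfunctor ::
  "('a, 'v::comm_unital_quantale) vcat \<Rightarrow> ('b, 'v) vcat \<Rightarrow> ('a \<Rightarrow> 'b) \<Rightarrow> bool" where
  "is_vfunctor X Y f \<longleftrightarrow>
     f \<in> obj X \<rightarrow> obj Y \<and>
     (\<forall>x\<in>obj X. \<forall>x'\<in>obj X. hom X x x' \<le> hom Y (f x) (f x'))"

definition vcat_iso ::
  "('a, 'v::comm_unital_quantale) vcat \<Rightarrow> ('b, 'v) vcat \<Rightarrow> bool" where
  "vcat_iso X Y \<longleftrightarrow>
     (\<exists>f g. is_vfunctor X Y f \<and> is_vfunctor Y X g \<and>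
            (\<forall>x\<in>obj X. g (f x) = x) \<and> (\<forall>y\<in>obj Y. f (g y) = y))"

definition is_vmodule ::
  "('a, 'v::comm_unital_quantale) vcat \<Rightarrow> ('b, 'v) vcat \<Rightarrow> ('a \<Rightarrow> 'b \<Rightarrow> 'v) \<Rightarrow> bool" where
  "is_vmodule X Y \<phi> \<longleftrightarrow>
     (\<forall>x'\<in>obj X. \<forall>x\<in>obj X. \<forall>y\<in>obj Y. hom X x' x * \<phi> x y \<le> \<phi> x' y) \<and>
     (\<forall>x\<in>obj X. \<forall>y\<in>obj Y. \<forall>y'\<in>obj Y. \<phi> x y * hom Y y y' \<le> \<phi> x y')"

definition tensor_vcat ::
  "('a, 'v::comm_unital_quantale) vcat \<Rightarrow> ('b, 'v) vcat \<Rightarrow> ('a \<times> 'b, 'v) vcat" where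
  "tensor_vcat X Y =
     \<lparr>obj = obj X \<times> obj Y, hom = (\<lambda>(x, y) (x', y'). hom X x x' * hom Y y y')\<rparr>"

definition unit_vcat :: "(unit, 'v::comm_unital_quantale) vcat" where
  "unit_vcat = \<lparr>obj = {()}, hom = (\<lambda>_ _. 1)\<rparr>"

definition prod_vcat ::
  "('a, 'v::comm_unital_quantale) vcat \<Rightarrow> ('b, 'v) vcat \<Rightarrow> ('a \<times> 'b, 'v) vcat" where
  "prod_vcat X Y =
     \<lparr>obj = obj X \<times> obj Y, hom = (\<lambda>(x, y) (x', y'). inf (hom X x x') (hom Y y y'))\<rparr>"

definition terminal_vcat :: "(unit, 'v::comm_unital_quantale) vcat" where
  "terminal_vcat = \<lparr>obj = {()}, hom = (\<lambda>_ _. top)\<rparr>"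

definition coprod_vcat ::
  "('a, 'v::comm_unital_quantale) vcat \<Rightarrow> ('b, 'v) vcat \<Rightarrow> ('a + 'b, 'v) vcat" where
  "coprod_vcat X Y =
     \<lparr>obj = obj X <+> obj Y,
      hom = (\<lambda>p q. case (p, q) of
                (Inl x, Inl x') \<Rightarrow> hom X x x'
              | (Inr y, Inr y') \<Rightarrow> hom Y y y'
              | _ \<Rightarrow> bot)\<rparr>"

definition empty_vcat :: "(unit, 'v::comm_unital_quantale) vcat" where
  "empty_vcat = \<lparr>obj = {}, hom = (\<lambda>_ _. bot)\<rparr>"

section \<open>Monoids in the monoidal category of large enriched categories\<close>

definition is_vcat_monoid ::
  "('a, 'v::comm_unital_quantale) vcat \<Rightarrow> ('a \<times> 'a \<Rightarrow> 'a) \<Rightarrow> (unit \<Rightarrow> 'a) \<Rightarrow> bool" where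
  "is_vcat_monoid M m e \<longleftrightarrow>
     is_vcat M \<and>
     is_vfunctor (tensor_vcat M M) M m \<and>
     is_vfunctor unit_vcat M e \<and>
     (\<forall>x\<in>obj M. \<forall>y\<in>obj M. \<forall>z\<in>obj M. m (m (x, y), z) = m (x, m (y, z))) \<and>
     (\<forall>x\<in>obj M. m (e (), x) = x \<and> m (x, e ()) = x)"

definition is_vcat_monoid_hom ::
  "('a, 'v::comm_unital_quantale) vcat \<Rightarrow> ('a \<times> 'a \<Rightarrow> 'a) \<Rightarrow> (unit \<Rightarrow> 'a) \<Rightarrow>
   ('b, 'v) vcat \<Rightarrow> ('b \<times> 'b \<Rightarrow> 'b) \<Rightarrow> (unit \<Rightarrow> 'b) \<Rightarrow> ('a \<Rightarrow> 'b) \<Rightarrow> bool" where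
  "is_vcat_monoid_hom M m e N n d f \<longleftrightarrow>
     is_vcat_monoid M m e \<and>
     is_vcat_monoid N n d \<and>
     is_vfunctor M N f \<and>
     (\<forall>x\<in>obj M. \<forall>y\<in>obj M. f (m (x, y)) = n (f x, f y)) \<and>
     f (e ()) = d ()"

section \<open>The Hausdorff functor\<close>

definition hausdorff_ext :: "('a \<Rightarrow> 'b \<Rightarrow> 'v::comm_unital_quantale) \<Rightarrow> 'a set \<Rightarrow> 'b set \<Rightarrow> 'v" where
  "hausdorff_ext \<phi> A B = (INF x\<in>A. SUP y\<in>B. \<phi> x y)"

text \<open>On morphisms the functor is \<open>f \<mapsto> (`) f\<close>; see \<open>is_vfunctor_image\<close> below.\<close>

definition hausdorff_vcat :: "('a, 'v::comm_unital_quantale) vcat \<Rightarrow> ('a set, 'v) vcat" where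
  "hausdorff_vcat X = \<lparr>obj = Pow (obj X), hom = hausdorff_ext (hom X)\<rparr>"

section \<open>Small sets\<close>

text \<open>
  A type with a membership relation satisfying the Zermelo--Fraenkel axioms; replacement and
  separation are second-order, so this is a Grothendieck universe. A set over the type
  is small if it is the extension \<open>elts x\<close> of an element \<open>x\<close>, and
  it may be large otherwise. Foundation and infinity are not imposed: universes satisfying them
  are included, but they are not needed.
\<close>

class set_universe =
  fixes elts :: "'a \<Rightarrow> 'a set"
  assumes elts_inject: "elts x = elts y \<Longrightarrow> x = y"
    and separation: "A \<subseteq> elts x \<Longrightarrow> A \<in> range elts"
    and replacement: "f ` elts x \<in> range elts"
    and union: "(\<Union>y\<in>elts x. elts y) \<in> range elts"
    and powerset: "{y. elts y \<subseteq> elts x} \<in> range elts"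

definition small_vcat :: "('u::set_universe, 'v::comm_unital_quantale) vcat \<Rightarrow> bool" where
  "small_vcat X \<longleftrightarrow> is_vcat X \<and> obj X \<in> range elts"

section \<open>Isomorphism classes and the Gromov structure\<close>

text \<open>
  The class of \<open>W\<close> consists of the small enriched categories isomorphic to \<open>W\<close>. Since \<open>W\<close> may live
  on another type, coproducts, products and powersets need not be encoded in the universe.
\<close>

definition iso_class ::
  "('w, 'v::comm_unital_quantale) vcat \<Rightarrow> ('u::set_universe, 'v) vcat set" where
  "iso_class W = {Z. small_vcat Z \<and> vcat_iso Z W}"

definition GH_mod ::
  "('a, 'v::comm_unital_quantale) vcat \<Rightarrow> ('b, 'v) vcat \<Rightarrow> 'v" where
  "GH_mod X Y = Sup {hausdorff_ext \<phi> (obj X) (obj Y) | \<phi>. is_vmodule X Y \<phi>}"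

text \<open>
  The functions on classes below are lifted from representatives; the lemmas \<open>GH_hom_iso_class\<close>,
  \<open>GH_plus_iso_class\<close>, \<open>GH_times_iso_class\<close> and \<open>GH_hausdorff_iso_class\<close> at the end show that
  they do not depend on the choice of representatives.
\<close>

definition GH_hom ::
  "('u::set_universe, 'v::comm_unital_quantale) vcat set \<Rightarrow> ('u, 'v) vcat set \<Rightarrow> 'v" where
  "GH_hom C D = the_elem (\<Union>X\<in>C. \<Union>Y\<in>D. {GH_mod X Y})"

definition GH :: "(('u::set_universe, 'v::comm_unital_quantale) vcat set, 'v) vcat" where
  "GH = \<lparr>obj = iso_class ` {X :: ('u, 'v) vcat. small_vcat X}, hom = GH_hom\<rparr>"

definition GH_plus ::
  "('u::set_universe, 'v::comm_unital_quantale) vcat set \<times> ('u, 'v) vcat set \<Rightarrow> ('u, 'v) vcat set" where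
  "GH_plus = (\<lambda>(C, D). \<Union>X\<in>C. \<Union>Y\<in>D. iso_class (coprod_vcat X Y))"

definition GH_zero :: "unit \<Rightarrow> ('u::set_universe, 'v::comm_unital_quantale) vcat set" where
  "GH_zero = (\<lambda>_. iso_class empty_vcat)"

definition GH_times ::
  "('u::set_universe, 'v::comm_unital_quantale) vcat set \<times> ('u, 'v) vcat set \<Rightarrow> ('u, 'v) vcat set" where
  "GH_times = (\<lambda>(C, D). \<Union>X\<in>C. \<Union>Y\<in>D. iso_class (prod_vcat X Y))"

definition GH_one :: "unit \<Rightarrow> ('u::set_universe, 'v::comm_unital_quantale) vcat set" where
  "GH_one = (\<lambda>_. iso_class terminal_vcat)"

definition GH_hausdorff ::
  "('u::set_universe, 'v::comm_unital_quantale) vcat set \<Rightarrow> ('u, 'v) vcat set" where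
  "GH_hausdorff C = (\<Union>X\<in>C. iso_class (hausdorff_vcat X))"

section \<open>Independence of representatives\<close>

lemma quantale_mult_mono:
  fixes p q s t :: "'v::comm_unital_quantale"
  assumes "p \<le> q" and "s \<le> t"
  shows "p * s \<le> q * t"
proof -
  have mono: "z * x \<le> z * y" if "x \<le> y" for x y z :: 'v
  proof -
    have "z * y = z * Sup {x, y}"
      using that by (simp add: sup_absorb2)
    also have "\<dots> = sup (z * x) (z * y)"
      unfolding mult_Sup by simp
    finally show ?thesis
      by (simp add: sup.absorb_iff2)
  qed
  show ?thesis
    using mono[OF assms(1), of s] mono[OF assms(2), of q] by (simp add: mult.commute)
qed

lemma UN_UN_eq:
  assumes "x \<in> A" and "y \<in> B" and "\<And>x y. x \<in> A \<Longrightarrow> y \<in> B \<Longrightarrow> F x y = C"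
  shows "(\<Union>x\<in>A. \<Union>y\<in>B. F x y) = C"
  using assms by blast

lemma is_vfunctor_id: "is_vfunctor X X (\<lambda>x. x)"
  by (simp add: is_vfunctor_def)

lemma is_vfunctor_comp:
  assumes "is_vfunctor X Y f" and "is_vfunctor Y Z g"
  shows "is_vfunctor X Z (\<lambda>x. g (f x))"
  using assms unfolding is_vfunctor_def Pi_iff by (meson order_trans)

lemma vcat_iso_refl: "vcat_iso X X"
  unfolding vcat_iso_def using is_vfunctor_id by fastforce

lemma vcat_iso_sym: "vcat_iso X Y \<Longrightarrow> vcat_iso Y X"
  unfolding vcat_iso_def by blast

lemma vcat_iso_trans:
  assumes "vcat_iso X Y" and "vcat_iso Y Z"
  shows "vcat_iso X Z"
proof -
  obtain f g where 1: "is_vfunctor X Y f" "is_vfunctor Y X g"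
    "\<forall>x\<in>obj X. g (f x) = x" "\<forall>y\<in>obj Y. f (g y) = y"
    using assms(1) unfolding vcat_iso_def by blast
  obtain f' g' where 2: "is_vfunctor Y Z f'" "is_vfunctor Z Y g'"
    "\<forall>x\<in>obj Y. g' (f' x) = x" "\<forall>y\<in>obj Z. f' (g' y) = y"
    using assms(2) unfolding vcat_iso_def by blast
  have "\<forall>x\<in>obj X. g (g' (f' (f x))) = x" "\<forall>z\<in>obj Z. f' (f (g (g' z))) = z"
    using 1 2 by (auto simp: is_vfunctor_def Pi_iff)
  then show ?thesis
    unfolding vcat_iso_def
    using is_vfunctor_comp[OF 1(1) 2(1)] is_vfunctor_comp[OF 2(2) 1(2)] by blast
qed

lemma iso_class_cong: "vcat_iso V W \<Longrightarrow> iso_class V = iso_class W"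
  unfolding iso_class_def by (meson vcat_iso_sym vcat_iso_trans)

lemma iso_class_self: "small_vcat X \<Longrightarrow> X \<in> iso_class X"
  by (simp add: iso_class_def vcat_iso_refl)

lemma is_vfunctor_image:
  assumes "is_vfunctor X Y f"
  shows "is_vfunctor (hausdorff_vcat X) (hausdorff_vcat Y) ((`) f)"
proof -
  have "hausdorff_ext (hom X) A B \<le> hausdorff_ext (hom Y) (f ` A) (f ` B)"
    if "A \<subseteq> obj X" "B \<subseteq> obj X" for A B
    unfolding hausdorff_ext_def
  proof (rule INF_greatest)
    fix y assume "y \<in> f ` A"
    then obtain x where x: "x \<in> A" "y = f x" by blast
    have "(INF x\<in>A. SUP x'\<in>B. hom X x x') \<le> (SUP x'\<in>B. hom X x x')"
      using x(1) by (rule INF_lower)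
    also have "\<dots> \<le> (SUP y'\<in>f ` B. hom Y y y')"
    proof (rule SUP_mono)
      fix x' assume "x' \<in> B"
      then have "hom X x x' \<le> hom Y y (f x')"
        using assms that x unfolding is_vfunctor_def by blast
      then show "\<exists>y'\<in>f ` B. hom X x x' \<le> hom Y y y'"
        using \<open>x' \<in> B\<close> by blast
    qed
    finally show "(INF x\<in>A. SUP x'\<in>B. hom X x x') \<le> (SUP y'\<in>f ` B. hom Y y y')" .
  qed
  then show ?thesis
    using assms by (auto simp: is_vfunctor_def hausdorff_vcat_def Pi_iff)
qed

lemma hausdorff_vcat_iso:
  assumes "vcat_iso X Y"
  shows "vcat_iso (hausdorff_vcat X) (hausdorff_vcat Y)"
proof -
  obtain f g where 1: "is_vfunctor X Y f" "is_vfunctor Y X g"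
    "\<forall>x\<in>obj X. g (f x) = x" "\<forall>y\<in>obj Y. f (g y) = y"
    using assms unfolding vcat_iso_def by blast
  have "\<forall>A\<in>obj (hausdorff_vcat X). g ` (f ` A) = A"
    "\<forall>B\<in>obj (hausdorff_vcat Y). f ` (g ` B) = B"
    using 1(3,4) by (auto simp: hausdorff_vcat_def image_image image_def subset_iff)
  then show ?thesis
    unfolding vcat_iso_def using is_vfunctor_image[OF 1(1)] is_vfunctor_image[OF 1(2)] by blast
qed

lemma coprod_vcat_iso:
  assumes "vcat_iso X X'" and "vcat_iso Y Y'"
  shows "vcat_iso (coprod_vcat X Y) (coprod_vcat X' Y')"
proof -
  obtain f g where 1: "is_vfunctor X X' f" "is_vfunctor X' X g"
    "\<forall>x\<in>obj X. g (f x) = x" "\<forall>y\<in>obj X'. f (g y) = y"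
    using assms(1) unfolding vcat_iso_def by blast
  obtain f' g' where 2: "is_vfunctor Y Y' f'" "is_vfunctor Y' Y g'"
    "\<forall>x\<in>obj Y. g' (f' x) = x" "\<forall>y\<in>obj Y'. f' (g' y) = y"
    using assms(2) unfolding vcat_iso_def by blast
  show ?thesis
    unfolding vcat_iso_def
    by (rule exI[of _ "map_sum f f'"], rule exI[of _ "map_sum g g'"])
      (use 1 2 in \<open>auto simp: is_vfunctor_def coprod_vcat_def Pi_iff\<close>)
qed

lemma prod_vcat_iso:
  assumes "vcat_iso X X'" and "vcat_iso Y Y'"
  shows "vcat_iso (prod_vcat X Y) (prod_vcat X' Y')"
proof -
  obtain f g where 1: "is_vfunctor X X' f" "is_vfunctor X' X g"
    "\<forall>x\<in>obj X. g (f x) = x" "\<forall>y\<in>obj X'. f (g y) = y"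
    using assms(1) unfolding vcat_iso_def by blast
  obtain f' g' where 2: "is_vfunctor Y Y' f'" "is_vfunctor Y' Y g'"
    "\<forall>x\<in>obj Y. g' (f' x) = x" "\<forall>y\<in>obj Y'. f' (g' y) = y"
    using assms(2) unfolding vcat_iso_def by blast
  show ?thesis
    unfolding vcat_iso_def
    by (rule exI[of _ "map_prod f f'"], rule exI[of _ "map_prod g g'"])
      (use 1 2 in \<open>auto simp: is_vfunctor_def prod_vcat_def Pi_iff intro: le_infI1 le_infI2\<close>)
qed

lemma GH_mod_le:
  assumes "vcat_iso X X'" and "vcat_iso Y Y'"
  shows "GH_mod X Y \<le> GH_mod X' Y'"
proof -
  obtain g where g: "is_vfunctor X' X g"
    using assms(1) unfolding vcat_iso_def by blast
  obtain u v where uv: "is_vfunctor Y Y' u" "is_vfunctor Y' Y v" "\<forall>y\<in>obj Y. v (u y) = y"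
    using assms(2) unfolding vcat_iso_def by blast
  have "hausdorff_ext \<phi> (obj X) (obj Y) \<le> GH_mod X' Y'" if \<phi>: "is_vmodule X Y \<phi>" for \<phi>
  proof -
    define \<psi> where "\<psi> = (\<lambda>x' y'. \<phi> (g x') (v y'))"
    have 1: "hom X' x' x * \<psi> x y \<le> \<psi> x' y" if "x' \<in> obj X'" "x \<in> obj X'" "y \<in> obj Y'" for x' x y
    proof -
      have "hom X' x' x * \<psi> x y \<le> hom X (g x') (g x) * \<psi> x y"
        using g that by (intro quantale_mult_mono) (auto simp: is_vfunctor_def)
      also have "\<dots> \<le> \<psi> x' y"
        using \<phi> g uv(2) that unfolding is_vmodule_def \<psi>_def is_vfunctor_def Pi_iff by blast
      finally show ?thesis .
    qed
    have 2: "\<psi> x y * hom Y' y y' \<le> \<psi> x y'" if "x \<in> obj X'" "y \<in> obj Y'" "y' \<in> obj Y'" for x y y'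
    proof -
      have "\<psi> x y * hom Y' y y' \<le> \<psi> x y * hom Y (v y) (v y')"
        using uv(2) that by (intro quantale_mult_mono) (auto simp: is_vfunctor_def)
      also have "\<dots> \<le> \<psi> x y'"
        using \<phi> g uv(2) that unfolding is_vmodule_def \<psi>_def is_vfunctor_def Pi_iff by blast
      finally show ?thesis .
    qed
    have "is_vmodule X' Y' \<psi>"
      using 1 2 unfolding is_vmodule_def by blast
    then have "hausdorff_ext \<psi> (obj X') (obj Y') \<le> GH_mod X' Y'"
      unfolding GH_mod_def by (blast intro: Sup_upper)
    moreover have "hausdorff_ext \<phi> (obj X) (obj Y) \<le> hausdorff_ext \<psi> (obj X') (obj Y')"
      unfolding hausdorff_ext_def
    proof (rule INF_greatest)
      fix x' assume "x' \<in> obj X'"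
      then have "(INF x\<in>obj X. SUP y\<in>obj Y. \<phi> x y) \<le> (SUP y\<in>obj Y. \<phi> (g x') y)"
        using g by (intro INF_lower) (auto simp: is_vfunctor_def)
      also have "\<dots> \<le> (SUP y'\<in>obj Y'. \<psi> x' y')"
      proof (rule SUP_mono)
        fix y assume "y \<in> obj Y"
        then show "\<exists>y'\<in>obj Y'. \<phi> (g x') y \<le> \<psi> x' y'"
          using uv by (intro bexI[of _ "u y"]) (auto simp: \<psi>_def is_vfunctor_def)
      qed
      finally show "(INF x\<in>obj X. SUP y\<in>obj Y. \<phi> x y) \<le> (SUP y'\<in>obj Y'. \<psi> x' y')" .
    qed
    ultimately show ?thesis by order
  qed
  then show ?thesis
    unfolding GH_mod_def[of X Y] by (blast intro: Sup_least)
qed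

lemma GH_mod_cong:
  assumes "vcat_iso X X'" and "vcat_iso Y Y'"
  shows "GH_mod X Y = GH_mod X' Y'"
  using assms by (meson GH_mod_le order_antisym vcat_iso_sym)

lemma GH_hom_iso_class:
  fixes X Y :: "('u::set_universe, 'v::comm_unital_quantale) vcat"
  assumes "small_vcat X" and "small_vcat Y"
  shows "GH_hom (iso_class X :: ('u, 'v) vcat set) (iso_class Y :: ('u, 'v) vcat set) = GH_mod X Y"
proof -
  have "(\<Union>X'\<in>(iso_class X :: ('u, 'v) vcat set). \<Union>Y'\<in>(iso_class Y :: ('u, 'v) vcat set).
          {GH_mod X' Y'}) = {GH_mod X Y}"
    using assms[THEN iso_class_self] GH_mod_cong by (intro UN_UN_eq) (auto simp: iso_class_def)
  then show ?thesis
    by (simp add: GH_hom_def)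
qed

lemma GH_plus_iso_class:
  fixes X Y :: "('u::set_universe, 'v::comm_unital_quantale) vcat"
  assumes "small_vcat X" and "small_vcat Y"
  shows "GH_plus (iso_class X :: ('u, 'v) vcat set, iso_class Y) = iso_class (coprod_vcat X Y)"
  unfolding GH_plus_def prod.case
proof (rule UN_UN_eq)
  show "X \<in> iso_class X" "Y \<in> iso_class Y"
    using assms by (auto intro: iso_class_self)
  show "iso_class (coprod_vcat X' Y') = iso_class (coprod_vcat X Y)"
    if "X' \<in> iso_class X" "Y' \<in> iso_class Y" for X' Y' :: "('u, 'v) vcat"
    using that by (intro iso_class_cong coprod_vcat_iso) (auto simp: iso_class_def)
qed

lemma GH_times_iso_class:
  fixes X Y :: "('u::set_universe, 'v::comm_unital_quantale) vcat"
  assumes "small_vcat X" and "small_vcat Y"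
  shows "GH_times (iso_class X :: ('u, 'v) vcat set, iso_class Y) = iso_class (prod_vcat X Y)"
  unfolding GH_times_def prod.case
proof (rule UN_UN_eq)
  show "X \<in> iso_class X" "Y \<in> iso_class Y"
    using assms by (auto intro: iso_class_self)
  show "iso_class (prod_vcat X' Y') = iso_class (prod_vcat X Y)"
    if "X' \<in> iso_class X" "Y' \<in> iso_class Y" for X' Y' :: "('u, 'v) vcat"
    using that by (intro iso_class_cong prod_vcat_iso) (auto simp: iso_class_def)
qed

lemma GH_hausdorff_iso_class:
  fixes X :: "('u::set_universe, 'v::comm_unital_quantale) vcat"
  assumes "small_vcat X"
  shows "GH_hausdorff (iso_class X :: ('u, 'v) vcat set) = iso_class (hausdorff_vcat X)"
proof -
  have "iso_class (hausdorff_vcat X') = (iso_class (hausdorff_vcat X) :: ('u, 'v) vcat set)"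
    if "X' \<in> iso_class X" for X' :: "('u, 'v) vcat"
    using that by (intro iso_class_cong hausdorff_vcat_iso) (auto simp: iso_class_def)
  then show ?thesis
    using iso_class_self[OF assms] unfolding GH_hausdorff_def by blast
qed

end

theory Submission
  imports Defs
begin

text \<open>
  Everything is computed on representatives. An isomorphism class that is the value of one of the
  operations is the class of a coproduct, a product or a powerset, which lives on a different type;
  such an enriched category still has a small representative because the universe is closed, up
  to injection, under sums, products and powersets. Hence the monoid laws and the two homomorphism
  equations reduce to isomorphisms of enriched categories: the usual associativity and unit
  isomorphisms, the isomorphism of \<open>H \<emptyset>\<close> with the terminal category, and
  \<open>H (X + Y) \<cong> H X \<times> H Y\<close>, which splits a subset of a disjoint union into its two parts.

  The enriched structure rests on \<open>hausdorff_ext_mult_le\<close>: the Hausdorff extension is laxly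
  compatible with the composition of quantale-valued relations. It gives the triangle inequality
  for \<open>GH\<close> and for \<open>H X\<close>, and shows that the extension of a module is a module
  \<open>H X \<rightarrow> H Y\<close>. The latter extension, evaluated at all subsets, is at least the original value on
  \<open>(X, Y)\<close> because the whole of \<open>Y\<close> is an admissible partner for every subset of \<open>X\<close>; so \<open>H\<close> is an
  enriched functor. The sum and the product of modules show that \<open>+\<close> and \<open>\<times>\<close> are enriched functors;
  there \<open>k = \<top>\<close> is used in the form \<open>u \<otimes> v \<le> u \<and> v\<close>.
\<close>

section \<open>Suprema and the tensor product\<close>

lemma bot_mult: "bot * x = (bot :: 'v::comm_unital_quantale)"
  using mult_Sup[of x "{}"] by (simp add: mult.commute)

lemma mult_bot: "x * bot = (bot :: 'v::comm_unital_quantale)"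
  by (simp add: mult.commute[of x] bot_mult)

lemma mult_SUP:
  fixes c :: "'v::comm_unital_quantale"
  shows "c * (SUP i\<in>I. f i) = (SUP i\<in>I. c * f i)"
  by (simp add: mult_Sup image_image)

lemma SUP_mult_least:
  fixes c d :: "'v::comm_unital_quantale"
  assumes "\<And>i. i \<in> I \<Longrightarrow> f i * c \<le> d"
  shows "(SUP i\<in>I. f i) * c \<le> d"
  using assms by (auto simp: mult_SUP mult.commute[of _ c] intro: SUP_least)

lemma mult_le_inf:
  fixes p q :: "'v::comm_unital_quantale"
  assumes "(1 :: 'v) = top"
  shows "p * q \<le> inf p q"
  using quantale_mult_mono[of p p q 1] quantale_mult_mono[of p 1 q q] assms by simp

lemma inf_mult_inf_le:
  fixes p q :: "'v::comm_unital_quantale"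
  assumes "p * q \<le> r" and "p' * q' \<le> r'"
  shows "inf p p' * inf q q' \<le> inf r r'"
proof (rule le_infI)
  show "inf p p' * inf q q' \<le> r"
    using quantale_mult_mono[of "inf p p'" p "inf q q'" q] assms(1) by simp
  show "inf p p' * inf q q' \<le> r'"
    using quantale_mult_mono[of "inf p p'" p' "inf q q'" q'] assms(2) by simp
qed

section \<open>The Hausdorff extension\<close>

lemma hausdorff_ext_greatest:
  "(\<And>x. x \<in> A \<Longrightarrow> c \<le> (SUP y\<in>B. \<phi> x y)) \<Longrightarrow> c \<le> hausdorff_ext \<phi> A B"
  unfolding hausdorff_ext_def by (rule INF_greatest)

lemma hausdorff_ext_lower:
  "x \<in> A \<Longrightarrow> hausdorff_ext \<phi> A B \<le> (SUP y\<in>B. \<phi> x y)"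
  unfolding hausdorff_ext_def by (rule INF_lower)

text \<open>
  For \<open>\<chi>\<close> the composite of \<open>\<phi>\<close> and \<open>\<psi>\<close> this is lax functoriality; the formulation with
  an arbitrary upper bound \<open>\<chi>\<close> also covers the transitivity of hom and the actions on a module.
\<close>

lemma hausdorff_ext_mult_le:
  fixes \<phi> :: "'a \<Rightarrow> 'b \<Rightarrow> 'v::comm_unital_quantale"
  assumes "\<And>x y z. x \<in> A \<Longrightarrow> y \<in> B \<Longrightarrow> z \<in> C \<Longrightarrow> \<phi> x y * \<psi> y z \<le> \<chi> x z"
  shows "hausdorff_ext \<phi> A B * hausdorff_ext \<psi> B C \<le> hausdorff_ext \<chi> A C"
proof (rule hausdorff_ext_greatest)
  fix x assume x: "x \<in> A"
  have "hausdorff_ext \<phi> A B * hausdorff_ext \<psi> B C \<le> (SUP y\<in>B. \<phi> x y) * hausdorff_ext \<psi> B C"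
    using x by (intro quantale_mult_mono hausdorff_ext_lower order_refl)
  also have "\<dots> \<le> (SUP z\<in>C. \<chi> x z)"
  proof (rule SUP_mult_least)
    fix y assume y: "y \<in> B"
    have "\<phi> x y * hausdorff_ext \<psi> B C \<le> \<phi> x y * (SUP z\<in>C. \<psi> y z)"
      using y by (intro quantale_mult_mono hausdorff_ext_lower order_refl)
    also have "\<dots> = (SUP z\<in>C. \<phi> x y * \<psi> y z)"
      by (rule mult_SUP)
    also have "\<dots> \<le> (SUP z\<in>C. \<chi> x z)"
      using x y assms by (intro SUP_mono) blast
    finally show "\<phi> x y * hausdorff_ext \<psi> B C \<le> (SUP z\<in>C. \<chi> x z)" .
  qed
  finally show "hausdorff_ext \<phi> A B * hausdorff_ext \<psi> B C \<le> (SUP z\<in>C. \<chi> x z)" .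
qed

lemma one_le_hausdorff_ext:
  assumes "is_vcat X" and "A \<subseteq> obj X"
  shows "1 \<le> hausdorff_ext (hom X) A A"
proof (rule hausdorff_ext_greatest)
  fix x assume "x \<in> A"
  then show "1 \<le> (SUP y\<in>A. hom X x y)"
    using assms by (intro SUP_upper2[of x]) (auto simp: is_vcat_def)
qed

section \<open>Enriched categories and their isomorphisms\<close>

lemma is_vcat_hausdorff: "is_vcat X \<Longrightarrow> is_vcat (hausdorff_vcat X)"
  unfolding is_vcat_def[of "hausdorff_vcat X"]
  by (auto simp: hausdorff_vcat_def one_le_hausdorff_ext intro!: hausdorff_ext_mult_le)
    (auto simp: is_vcat_def subset_iff)

lemma is_vcat_coprod: "is_vcat X \<Longrightarrow> is_vcat Y \<Longrightarrow> is_vcat (coprod_vcat X Y)"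
  by (auto simp: is_vcat_def coprod_vcat_def bot_mult mult_bot)

lemma is_vcat_prod: "is_vcat X \<Longrightarrow> is_vcat Y \<Longrightarrow> is_vcat (prod_vcat X Y)"
  by (auto simp: is_vcat_def prod_vcat_def simp del: le_inf_iff inf.bounded_iff
    intro!: le_infI[of 1] inf_mult_inf_le)

lemma is_vcat_empty: "is_vcat empty_vcat"
  by (simp add: is_vcat_def empty_vcat_def)

lemma is_vcat_terminal: "is_vcat terminal_vcat"
  by (simp add: is_vcat_def terminal_vcat_def)

lemma vcat_isoI:
  assumes "\<And>x. x \<in> obj X \<Longrightarrow> f x \<in> obj Y \<and> g (f x) = x"
    and "\<And>y. y \<in> obj Y \<Longrightarrow> g y \<in> obj X \<and> f (g y) = y"
    and hom: "\<And>x x'. x \<in> obj X \<Longrightarrow> x' \<in> obj X \<Longrightarrow> hom X x x' = hom Y (f x) (f x')"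
  shows "vcat_iso X Y"
  unfolding vcat_iso_def
proof (intro exI conjI)
  show "is_vfunctor X Y f"
    using assms by (auto simp: is_vfunctor_def)
  show "is_vfunctor Y X g"
    using assms(1,2) hom[of "g _" "g _"] by (auto simp: is_vfunctor_def)
qed (use assms in auto)

lemma coprod_vcat_assoc:
  "vcat_iso (coprod_vcat (coprod_vcat X Y) Z) (coprod_vcat X (coprod_vcat Y Z))"
  by (rule vcat_isoI[where
        f = "case_sum (case_sum Inl (\<lambda>y. Inr (Inl y))) (\<lambda>z. Inr (Inr z))" and
        g = "case_sum (\<lambda>x. Inl (Inl x)) (case_sum (\<lambda>y. Inl (Inr y)) Inr)"])
    (auto simp: coprod_vcat_def)

lemma coprod_vcat_empty_left: "vcat_iso (coprod_vcat empty_vcat X) X"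
  by (rule vcat_isoI[where f = "case_sum (\<lambda>_. undefined) (\<lambda>x. x)" and g = Inr])
    (auto simp: coprod_vcat_def empty_vcat_def)

lemma coprod_vcat_empty_right: "vcat_iso (coprod_vcat X empty_vcat) X"
  by (rule vcat_isoI[where f = "case_sum (\<lambda>x. x) (\<lambda>_. undefined)" and g = Inl])
    (auto simp: coprod_vcat_def empty_vcat_def)

lemma prod_vcat_assoc:
  "vcat_iso (prod_vcat (prod_vcat X Y) Z) (prod_vcat X (prod_vcat Y Z))"
  by (rule vcat_isoI[where f = "\<lambda>((x, y), z). (x, (y, z))" and g = "\<lambda>(x, (y, z)). ((x, y), z)"])
    (auto simp: prod_vcat_def inf.assoc)

lemma prod_vcat_terminal_left: "vcat_iso (prod_vcat terminal_vcat X) X"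
  by (rule vcat_isoI[where f = snd and g = "Pair ()"]) (auto simp: prod_vcat_def terminal_vcat_def)

lemma prod_vcat_terminal_right: "vcat_iso (prod_vcat X terminal_vcat) X"
  by (rule vcat_isoI[where f = fst and g = "\<lambda>x. (x, ())"])
    (auto simp: prod_vcat_def terminal_vcat_def)

lemma hausdorff_vcat_empty: "vcat_iso (hausdorff_vcat empty_vcat) terminal_vcat"
  by (rule vcat_isoI[where f = "\<lambda>_. ()" and g = "\<lambda>_. {}"])
    (auto simp: hausdorff_vcat_def hausdorff_ext_def empty_vcat_def terminal_vcat_def)

lemma hausdorff_ext_coprod:
  "hausdorff_ext (hom (coprod_vcat X Y)) (A <+> B) (A' <+> B') =
     inf (hausdorff_ext (hom X) A A') (hausdorff_ext (hom Y) B B')"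
proof -
  let ?h = "hom (coprod_vcat X Y)"
  have l: "(SUP q\<in>A' <+> B'. ?h (Inl x) q) = (SUP x'\<in>A'. hom X x x')" for x
    by (auto simp: Plus_def SUP_union image_image coprod_vcat_def intro!: antisym SUP_least)
  have r: "(SUP q\<in>A' <+> B'. ?h (Inr y) q) = (SUP y'\<in>B'. hom Y y y')" for y
    by (auto simp: Plus_def SUP_union image_image coprod_vcat_def intro!: antisym SUP_least)
  show ?thesis
    unfolding hausdorff_ext_def Plus_def[of A B] INF_union by (simp add: image_image l r)
qed

lemma hausdorff_vcat_coprod:
  "vcat_iso (hausdorff_vcat (coprod_vcat X Y)) (prod_vcat (hausdorff_vcat X) (hausdorff_vcat Y))"
proof (rule vcat_isoI[where f = "\<lambda>C. (Inl -` C, Inr -` C)" and g = "\<lambda>(A, B). A <+> B"])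
  have split: "(Inl -` C) <+> (Inr -` C) = C" for C :: "('a + 'b) set"
  proof (rule set_eqI)
    show "p \<in> (Inl -` C) <+> (Inr -` C) \<longleftrightarrow> p \<in> C" for p
      by (cases p) auto
  qed
  show "hom (hausdorff_vcat (coprod_vcat X Y)) C C' =
      hom (prod_vcat (hausdorff_vcat X) (hausdorff_vcat Y))
        (Inl -` C, Inr -` C) (Inl -` C', Inr -` C')" for C C'
    using hausdorff_ext_coprod[of X Y "Inl -` C" "Inr -` C" "Inl -` C'" "Inr -` C'"]
    by (simp add: split hausdorff_vcat_def prod_vcat_def)
  show "(Inl -` C, Inr -` C) \<in> obj (prod_vcat (hausdorff_vcat X) (hausdorff_vcat Y)) \<and>
      (case (Inl -` C, Inr -` C) of (A, B) \<Rightarrow> A <+> B) = C"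
    if "C \<in> obj (hausdorff_vcat (coprod_vcat X Y))" for C
    using that by (auto simp: split hausdorff_vcat_def prod_vcat_def coprod_vcat_def)
qed (auto simp: hausdorff_vcat_def prod_vcat_def coprod_vcat_def)

section \<open>Essentially small sets\<close>

text \<open>
  A set over any type is essentially small, relative to the universe \<open>'u\<close>, if it injects into the
  extension of an element of \<open>'u\<close>.
\<close>

definition ess_small :: "'u::set_universe itself \<Rightarrow> 'a set \<Rightarrow> bool" where
  "ess_small U S \<longleftrightarrow> (\<exists>(f :: 'a \<Rightarrow> 'u) x. inj_on f S \<and> f ` S \<subseteq> elts x)"

lemma ess_smallE:
  assumes "ess_small TYPE('u::set_universe) S"
  obtains f :: "'a \<Rightarrow> 'u::set_universe" and x where "inj_on f S" and "f ` S \<subseteq> elts x"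
  using assms unfolding ess_small_def by blast

lemma ess_small_inj:
  assumes "ess_small TYPE('u::set_universe) (T :: 'b set)"
    and "inj_on f (S :: 'a set)" and "f ` S \<subseteq> T"
  shows "ess_small TYPE('u) S"
proof -
  obtain g :: "'b \<Rightarrow> 'u" and x where g: "inj_on g T" "g ` T \<subseteq> elts x"
    using assms(1) by (rule ess_smallE)
  have "inj_on (g \<circ> f) S"
    using assms(2,3) g(1) by (meson comp_inj_on inj_on_subset)
  moreover have "(g \<circ> f) ` S \<subseteq> elts x"
    using assms(3) g(2) by auto
  ultimately show ?thesis
    unfolding ess_small_def by blast
qed

lemma ess_small_elts: "ess_small TYPE('u::set_universe) (elts (x :: 'u))"
  unfolding ess_small_def by (rule exI[of _ id]) auto

text \<open>
  Pairing is not among the closure properties of the universe, but follows from them: the power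
  set of the power set of the empty set has two elements, which replacement sends to \<open>a\<close> and \<open>b\<close>.
\<close>

lemma elts_pair: "\<exists>z :: 'u::set_universe. elts z = {a, b}"
proof -
  obtain e :: 'u where e: "elts e = {}"
    using separation[of "{}" undefined] by auto
  then have e_iff: "elts y = {} \<longleftrightarrow> y = e" for y
    using elts_inject by metis
  obtain p where p: "elts p = {e}"
    using powerset[of e] e e_iff by (auto simp: subset_empty)
  obtain q where q: "elts q = {y. elts y \<subseteq> {e}}"
    using powerset[of p] unfolding p by auto
  have mem: "e \<in> elts q" "p \<in> elts q" "p \<noteq> e"
    using e p q by auto
  let ?f = "\<lambda>y. if y = e then a else b"
  have "?f ` elts q = {a, b}"
    using mem by (auto intro: image_eqI[of a ?f e] image_eqI[of b ?f p])
  then show ?thesis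
    using replacement[of ?f q] by auto
qed

lemma elts_Un: "\<exists>z :: 'u::set_universe. elts z = elts x \<union> elts y"
proof -
  obtain w where "elts w = {x, y}"
    using elts_pair by blast
  then show ?thesis
    using union[of w] by auto
qed

lemma ess_small_Pow:
  assumes "ess_small TYPE('u::set_universe) S"
  shows "ess_small TYPE('u) (Pow S)"
proof -
  obtain f :: "'a \<Rightarrow> 'u" and x where f: "inj_on f S" "f ` S \<subseteq> elts x"
    using assms by (rule ess_smallE)
  obtain p where p: "elts p = {y. elts y \<subseteq> elts x}"
    using powerset[of x] by auto
  define F where "F = (\<lambda>A. inv elts (f ` A))"
  have F: "elts (F A) = f ` A" if "A \<in> Pow S" for A
    unfolding F_def using that f(2) by (intro f_inv_into_f separation) blast
  have "inj_on F (Pow S)"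
    using F f(1) by (metis inj_onI inj_on_image_eq_iff PowD)
  moreover have "F ` Pow S \<subseteq> elts p"
    using F f(2) p by (auto simp: image_subset_iff subset_iff)
  ultimately show ?thesis
    unfolding ess_small_def by blast
qed

lemma ess_small_Times:
  assumes "ess_small TYPE('u::set_universe) S" and "ess_small TYPE('u) T"
  shows "ess_small TYPE('u) (S \<times> T)"
proof -
  obtain f :: "'a \<Rightarrow> 'u" and x where f: "inj_on f S" "f ` S \<subseteq> elts x"
    using assms(1) by (rule ess_smallE)
  obtain g :: "'b \<Rightarrow> 'u" and y where g: "inj_on g T" "g ` T \<subseteq> elts y"
    using assms(2) by (rule ess_smallE)
  obtain z where z: "elts z = elts x \<union> elts y"
    using elts_Un by blast
  \<comment> \<open>Kuratowski pairs\<close>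
  let ?K = "\<lambda>(a, b). {{f a}, {f a, g b}}"
  have K: "a = a' \<and> b = b'"
    if "a \<in> S" "b \<in> T" "a' \<in> S" "b' \<in> T" "?K (a, b) = ?K (a', b')" for a b a' b'
  proof -
    have "f a = f a' \<and> g b = g b'"
      using that(5) by (simp add: doubleton_eq_iff) metis
    then show ?thesis
      using f(1) g(1) that(1-4) by (meson inj_onD)
  qed
  have "inj_on ?K (S \<times> T)"
    by (rule inj_onI) (use K in blast)
  moreover have "?K ` (S \<times> T) \<subseteq> Pow (Pow (elts z))"
    using f(2) g(2) z by auto
  ultimately show ?thesis
    by (rule ess_small_inj[OF ess_small_Pow[OF ess_small_Pow[OF ess_small_elts]]])
qed

lemma ess_small_Plus:
  assumes "ess_small TYPE('u::set_universe) S" and "ess_small TYPE('u) T"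
  shows "ess_small TYPE('u) (S <+> T)"
proof (rule ess_small_inj)
  show "ess_small TYPE('u) (Pow S \<times> Pow T)"
    using assms by (intro ess_small_Times ess_small_Pow)
  let ?f = "case_sum (\<lambda>a. ({a}, {})) (\<lambda>b. ({}, {b}))"
  show "inj_on ?f (S <+> T)" and "?f ` (S <+> T) \<subseteq> Pow S \<times> Pow T"
    by (auto simp: inj_on_def)
qed

lemma ess_small_unit: "ess_small TYPE('u::set_universe) (S :: unit set)"
proof -
  obtain z :: 'u where "elts z = {undefined, undefined}"
    using elts_pair by blast
  then show ?thesis
    unfolding ess_small_def by (intro exI[of _ "\<lambda>_. undefined"] exI[of _ z]) (auto simp: inj_on_def)
qed

section \<open>Essentially small enriched categories\<close>

text \<open>
  An enriched category is essentially small if its set of objects is; it is then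
  isomorphic to a small one (\<open>ess_small_vcatE\<close>).
\<close>

definition ess_small_vcat ::
  "'u::set_universe itself \<Rightarrow> ('a, 'v::comm_unital_quantale) vcat \<Rightarrow> bool" where
  "ess_small_vcat U W \<longleftrightarrow> is_vcat W \<and> ess_small U (obj W)"

lemma small_vcat_ess_small:
  "small_vcat (X :: ('u::set_universe, 'v::comm_unital_quantale) vcat) \<Longrightarrow> ess_small_vcat TYPE('u) X"
  by (auto simp: small_vcat_def ess_small_vcat_def ess_small_elts)

lemma ess_small_vcatE:
  fixes W :: "('a, 'v::comm_unital_quantale) vcat"
  assumes "ess_small_vcat TYPE('u::set_universe) W"
  obtains X :: "('u::set_universe, 'v::comm_unital_quantale) vcat"
  where "small_vcat X" and "vcat_iso X W" and "iso_class X = (iso_class W :: ('u, 'v) vcat set)"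
proof -
  obtain f :: "'a \<Rightarrow> 'u" and x where f: "inj_on f (obj W)" "f ` obj W \<subseteq> elts x"
    using assms ess_smallE unfolding ess_small_vcat_def by blast
  let ?g = "inv_into (obj W) f"
  define X where "X = \<lparr>obj = f ` obj W, hom = (\<lambda>a b. hom W (?g a) (?g b))\<rparr>"
  have "is_vcat X"
    using assms f(1) by (auto simp: X_def ess_small_vcat_def is_vcat_def)
  then have "small_vcat X"
    using separation[OF f(2)] by (simp add: small_vcat_def X_def)
  moreover have "vcat_iso X W"
    by (rule vcat_isoI[where f = ?g and g = f]) (use f(1) in \<open>auto simp: X_def\<close>)
  ultimately show thesis
    by (intro that iso_class_cong)
qed

lemma ess_small_vcat_hausdorff:
  "ess_small_vcat TYPE('u::set_universe) X \<Longrightarrow> ess_small_vcat TYPE('u) (hausdorff_vcat X)"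
  unfolding ess_small_vcat_def
  by (simp add: is_vcat_hausdorff) (simp add: hausdorff_vcat_def ess_small_Pow)

lemma ess_small_vcat_coprod:
  "ess_small_vcat TYPE('u::set_universe) X \<Longrightarrow> ess_small_vcat TYPE('u) Y \<Longrightarrow>
     ess_small_vcat TYPE('u) (coprod_vcat X Y)"
  unfolding ess_small_vcat_def
  by (simp add: is_vcat_coprod) (simp add: coprod_vcat_def ess_small_Plus)

lemma ess_small_vcat_prod:
  "ess_small_vcat TYPE('u::set_universe) X \<Longrightarrow> ess_small_vcat TYPE('u) Y \<Longrightarrow>
     ess_small_vcat TYPE('u) (prod_vcat X Y)"
  unfolding ess_small_vcat_def
  by (simp add: is_vcat_prod) (simp add: prod_vcat_def ess_small_Times)

lemma ess_small_vcat_empty: "ess_small_vcat TYPE('u::set_universe) empty_vcat"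
  by (simp add: ess_small_vcat_def is_vcat_empty ess_small_unit)

lemma ess_small_vcat_terminal: "ess_small_vcat TYPE('u::set_universe) terminal_vcat"
  by (simp add: ess_small_vcat_def is_vcat_terminal ess_small_unit)

lemma iso_class_in_GH:
  assumes "ess_small_vcat TYPE('u::set_universe) W"
  shows "iso_class W \<in> obj (GH :: (('u, 'v::comm_unital_quantale) vcat set, 'v) vcat)"
proof -
  obtain X :: "('u, 'v) vcat" where "small_vcat X"
      "iso_class W = (iso_class X :: ('u, 'v) vcat set)"
    using assms by (metis ess_small_vcatE)
  then show ?thesis
    by (auto simp: GH_def)
qed

lemma GH_objE:
  assumes "C \<in> obj (GH :: (('u::set_universe, 'v::comm_unital_quantale) vcat set, 'v) vcat)"
  obtains X :: "('u::set_universe, 'v::comm_unital_quantale) vcat"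
  where "ess_small_vcat TYPE('u) X" and "C = iso_class X"
  using assms small_vcat_ess_small by (auto simp: GH_def)

text \<open>Hom-values and operations on classes can be computed on any essentially small representatives.\<close>

lemma hom_GH_ess_small:
  fixes V :: "('a, 'v::comm_unital_quantale) vcat" and W :: "('b, 'v) vcat"
  assumes "ess_small_vcat TYPE('u::set_universe) V" and "ess_small_vcat TYPE('u) W"
  shows "hom GH (iso_class V :: ('u, 'v) vcat set) (iso_class W) = GH_mod V W"
proof -
  obtain X :: "('u, 'v) vcat" where X: "small_vcat X" "vcat_iso X V"
      "iso_class X = (iso_class V :: ('u, 'v) vcat set)"
    using assms(1) by (rule ess_small_vcatE)
  obtain Y :: "('u, 'v) vcat" where Y: "small_vcat Y" "vcat_iso Y W"
      "iso_class Y = (iso_class W :: ('u, 'v) vcat set)"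
    using assms(2) by (rule ess_small_vcatE)
  show ?thesis
    using GH_hom_iso_class[OF X(1) Y(1)] GH_mod_cong[OF X(2) Y(2)] by (simp add: GH_def X(3) Y(3))
qed

lemma GH_plus_ess_small:
  fixes V :: "('a, 'v::comm_unital_quantale) vcat" and W :: "('b, 'v) vcat"
  assumes "ess_small_vcat TYPE('u::set_universe) V" and "ess_small_vcat TYPE('u) W"
  shows "GH_plus (iso_class V :: ('u, 'v) vcat set, iso_class W) = iso_class (coprod_vcat V W)"
proof -
  obtain X :: "('u, 'v) vcat" where X: "small_vcat X" "vcat_iso X V"
      "iso_class X = (iso_class V :: ('u, 'v) vcat set)"
    using assms(1) by (rule ess_small_vcatE)
  obtain Y :: "('u, 'v) vcat" where Y: "small_vcat Y" "vcat_iso Y W"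
      "iso_class Y = (iso_class W :: ('u, 'v) vcat set)"
    using assms(2) by (rule ess_small_vcatE)
  show ?thesis
    unfolding X(3)[symmetric] Y(3)[symmetric] GH_plus_iso_class[OF X(1) Y(1)]
    by (intro iso_class_cong coprod_vcat_iso X(2) Y(2))
qed

lemma GH_times_ess_small:
  fixes V :: "('a, 'v::comm_unital_quantale) vcat" and W :: "('b, 'v) vcat"
  assumes "ess_small_vcat TYPE('u::set_universe) V" and "ess_small_vcat TYPE('u) W"
  shows "GH_times (iso_class V :: ('u, 'v) vcat set, iso_class W) = iso_class (prod_vcat V W)"
proof -
  obtain X :: "('u, 'v) vcat" where X: "small_vcat X" "vcat_iso X V"
      "iso_class X = (iso_class V :: ('u, 'v) vcat set)"
    using assms(1) by (rule ess_small_vcatE)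
  obtain Y :: "('u, 'v) vcat" where Y: "small_vcat Y" "vcat_iso Y W"
      "iso_class Y = (iso_class W :: ('u, 'v) vcat set)"
    using assms(2) by (rule ess_small_vcatE)
  show ?thesis
    unfolding X(3)[symmetric] Y(3)[symmetric] GH_times_iso_class[OF X(1) Y(1)]
    by (intro iso_class_cong prod_vcat_iso X(2) Y(2))
qed

lemma GH_hausdorff_ess_small:
  fixes W :: "('a, 'v::comm_unital_quantale) vcat"
  assumes "ess_small_vcat TYPE('u::set_universe) W"
  shows "GH_hausdorff (iso_class W :: ('u, 'v) vcat set) = iso_class (hausdorff_vcat W)"
proof -
  obtain X :: "('u, 'v) vcat" where X: "small_vcat X" "vcat_iso X W"
      "iso_class X = (iso_class W :: ('u, 'v) vcat set)"
    using assms by (rule ess_small_vcatE)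
  show ?thesis
    unfolding X(3)[symmetric] GH_hausdorff_iso_class[OF X(1)]
    by (intro iso_class_cong hausdorff_vcat_iso X(2))
qed

section \<open>The Gromov structure on representatives\<close>

lemma hausdorff_ext_le_GH_mod:
  "is_vmodule X Y \<phi> \<Longrightarrow> hausdorff_ext \<phi> (obj X) (obj Y) \<le> GH_mod X Y"
  unfolding GH_mod_def by (blast intro: Sup_upper)

lemma GH_mod_least:
  assumes "\<And>\<phi>. is_vmodule X Y \<phi> \<Longrightarrow> hausdorff_ext \<phi> (obj X) (obj Y) \<le> c"
  shows "GH_mod X Y \<le> c"
  unfolding GH_mod_def using assms by (blast intro: Sup_least)

lemma GH_mod_mult_least:
  fixes X :: "('a, 'v::comm_unital_quantale) vcat"
  assumes "\<And>\<phi> \<psi>. is_vmodule X Y \<phi> \<Longrightarrow> is_vmodule X' Y' \<psi> \<Longrightarrow>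
      hausdorff_ext \<phi> (obj X) (obj Y) * hausdorff_ext \<psi> (obj X') (obj Y') \<le> c"
  shows "GH_mod X Y * GH_mod X' Y' \<le> c"
proof -
  have GH_mod_eq: "GH_mod V W = (SUP \<phi>\<in>{\<phi>. is_vmodule V W \<phi>}. hausdorff_ext \<phi> (obj V) (obj W))"
    for V :: "('e, 'v) vcat" and W :: "('f, 'v) vcat"
    unfolding GH_mod_def by (simp add: setcompr_eq_image)
  show ?thesis
    unfolding GH_mod_eq
    by (rule SUP_mult_least, unfold mult_SUP, rule SUP_least) (use assms in simp)
qed

lemma one_le_GH_mod:
  assumes "is_vcat X"
  shows "1 \<le> GH_mod X X"
proof -
  have "is_vmodule X X (hom X)"
    using assms by (simp add: is_vmodule_def is_vcat_def)
  then show ?thesis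
    using one_le_hausdorff_ext[OF assms order_refl] hausdorff_ext_le_GH_mod order_trans by blast
qed

lemma GH_mod_triangle: "GH_mod X Y * GH_mod Y Z \<le> GH_mod X Z"
proof (rule GH_mod_mult_least)
  fix \<phi> \<psi> assume \<phi>: "is_vmodule X Y \<phi>" and \<psi>: "is_vmodule Y Z \<psi>"
  \<comment> \<open>the composite module\<close>
  define \<chi> where "\<chi> = (\<lambda>x z. SUP y\<in>obj Y. \<phi> x y * \<psi> y z)"
  have le: "\<phi> x y * \<psi> y z \<le> \<chi> x z" if "y \<in> obj Y" for x y z
    unfolding \<chi>_def using that by (rule SUP_upper)
  have left: "hom X x' x * \<chi> x z \<le> \<chi> x' z" if "x' \<in> obj X" "x \<in> obj X" for x' x z
  proof -
    have "hom X x' x * (\<phi> x y * \<psi> y z) \<le> \<chi> x' z" if "y \<in> obj Y" for y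
    proof -
      have "hom X x' x * (\<phi> x y * \<psi> y z) \<le> \<phi> x' y * \<psi> y z"
        unfolding mult.assoc[symmetric]
        using \<phi> that \<open>x' \<in> obj X\<close> \<open>x \<in> obj X\<close>
        by (intro quantale_mult_mono order_refl) (simp add: is_vmodule_def)
      then show ?thesis
        using le[OF that] order_trans by blast
    qed
    then show ?thesis
      unfolding \<chi>_def[THEN fun_cong, THEN fun_cong, of x z] mult_SUP by (auto intro!: SUP_least)
  qed
  have right: "\<chi> x z * hom Z z z' \<le> \<chi> x z'" if "z \<in> obj Z" "z' \<in> obj Z" for x z z'
    unfolding \<chi>_def[THEN fun_cong, THEN fun_cong, of x z]
  proof (rule SUP_mult_least)
    fix y assume y: "y \<in> obj Y"
    have "\<phi> x y * \<psi> y z * hom Z z z' \<le> \<phi> x y * \<psi> y z'"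
      unfolding mult.assoc
      using \<psi> that y by (intro quantale_mult_mono order_refl) (simp add: is_vmodule_def)
    then show "\<phi> x y * \<psi> y z * hom Z z z' \<le> \<chi> x z'"
      using le[OF y] order_trans by blast
  qed
  have "is_vmodule X Z \<chi>"
    using left right by (simp add: is_vmodule_def)
  moreover have "hausdorff_ext \<phi> (obj X) (obj Y) * hausdorff_ext \<psi> (obj Y) (obj Z)
      \<le> hausdorff_ext \<chi> (obj X) (obj Z)"
    using le by (rule hausdorff_ext_mult_le)
  ultimately show "hausdorff_ext \<phi> (obj X) (obj Y) * hausdorff_ext \<psi> (obj Y) (obj Z) \<le> GH_mod X Z"
    using hausdorff_ext_le_GH_mod order_trans by blast
qed

lemma GH_mod_coprod:
  fixes X :: "('a, 'v::comm_unital_quantale) vcat"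
  assumes "(1 :: 'v) = top"
  shows "GH_mod X X' * GH_mod Y Y' \<le> GH_mod (coprod_vcat X Y) (coprod_vcat X' Y')"
proof (rule GH_mod_mult_least)
  fix \<phi> \<psi> assume \<phi>: "is_vmodule X X' \<phi>" and \<psi>: "is_vmodule Y Y' \<psi>"
  define \<chi> where "\<chi> = (\<lambda>p q. case (p, q) of (Inl x, Inl x') \<Rightarrow> \<phi> x x'
    | (Inr y, Inr y') \<Rightarrow> \<psi> y y' | _ \<Rightarrow> bot)"
  have "is_vmodule (coprod_vcat X Y) (coprod_vcat X' Y') \<chi>"
    unfolding is_vmodule_def[of "coprod_vcat X Y"]
    by (auto simp: coprod_vcat_def \<chi>_def bot_mult mult_bot)
      (use \<phi> \<psi> in \<open>simp_all add: is_vmodule_def\<close>)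
  moreover have "hausdorff_ext \<phi> (obj X) (obj X') * hausdorff_ext \<psi> (obj Y) (obj Y')
      \<le> hausdorff_ext \<chi> (obj (coprod_vcat X Y)) (obj (coprod_vcat X' Y'))"
    (is "?l * ?r \<le> _")
  proof (rule hausdorff_ext_greatest)
    fix p assume p: "p \<in> obj (coprod_vcat X Y)"
    have l: "?l * ?r \<le> ?l" and r: "?l * ?r \<le> ?r"
      using mult_le_inf[OF assms, of ?l ?r] by simp_all
    show "?l * ?r \<le> (SUP q\<in>obj (coprod_vcat X' Y'). \<chi> p q)"
    proof (cases p)
      case (Inl x)
      with p have "?l \<le> (SUP x'\<in>obj X'. \<phi> x x')"
        by (intro hausdorff_ext_lower) (auto simp: coprod_vcat_def)
      also have "\<dots> \<le> (SUP q\<in>obj (coprod_vcat X' Y'). \<chi> p q)"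
        by (rule SUP_least, rule SUP_upper2[of "Inl _"]) (auto simp: Inl \<chi>_def coprod_vcat_def)
      finally show ?thesis
        by (rule order_trans[OF l])
    next
      case (Inr y)
      with p have "?r \<le> (SUP y'\<in>obj Y'. \<psi> y y')"
        by (intro hausdorff_ext_lower) (auto simp: coprod_vcat_def)
      also have "\<dots> \<le> (SUP q\<in>obj (coprod_vcat X' Y'). \<chi> p q)"
        by (rule SUP_least, rule SUP_upper2[of "Inr _"]) (auto simp: Inr \<chi>_def coprod_vcat_def)
      finally show ?thesis
        by (rule order_trans[OF r])
    qed
  qed
  ultimately show "?l * ?r \<le> GH_mod (coprod_vcat X Y) (coprod_vcat X' Y')"
    by (meson hausdorff_ext_le_GH_mod order_trans)
qed

lemma GH_mod_prod:
  fixes X :: "('a, 'v::comm_unital_quantale) vcat"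
  assumes "(1 :: 'v) = top"
  shows "GH_mod X X' * GH_mod Y Y' \<le> GH_mod (prod_vcat X Y) (prod_vcat X' Y')"
proof (rule GH_mod_mult_least)
  fix \<phi> \<psi> assume \<phi>: "is_vmodule X X' \<phi>" and \<psi>: "is_vmodule Y Y' \<psi>"
  define \<chi> where "\<chi> = (\<lambda>(x, y) (x', y'). inf (\<phi> x x') (\<psi> y y'))"
  have "is_vmodule (prod_vcat X Y) (prod_vcat X' Y') \<chi>"
    using \<phi> \<psi> by (auto simp: is_vmodule_def prod_vcat_def \<chi>_def simp del: le_inf_iff inf.bounded_iff
      intro!: inf_mult_inf_le)
  moreover have "hausdorff_ext \<phi> (obj X) (obj X') * hausdorff_ext \<psi> (obj Y) (obj Y')
      \<le> hausdorff_ext \<chi> (obj (prod_vcat X Y)) (obj (prod_vcat X' Y'))"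
    (is "?l * ?r \<le> _")
  proof (rule hausdorff_ext_greatest)
    fix p assume p: "p \<in> obj (prod_vcat X Y)"
    obtain x y where xy: "p = (x, y)" "x \<in> obj X" "y \<in> obj Y"
      using p by (auto simp: prod_vcat_def)
    have "?l * ?r \<le> (SUP x'\<in>obj X'. \<phi> x x') * (SUP y'\<in>obj Y'. \<psi> y y')"
      using xy by (intro quantale_mult_mono hausdorff_ext_lower)
    also have "\<dots> \<le> (SUP q\<in>obj (prod_vcat X' Y'). \<chi> p q)"
    proof (rule SUP_mult_least, unfold mult_SUP, rule SUP_least)
      fix x' y' assume "x' \<in> obj X'" "y' \<in> obj Y'"
      then show "\<phi> x x' * \<psi> y y' \<le> (SUP q\<in>obj (prod_vcat X' Y'). \<chi> p q)"
        by (intro SUP_upper2[of "(x', y')"])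
          (use mult_le_inf[OF assms] in \<open>auto simp: xy(1) \<chi>_def prod_vcat_def
            simp del: le_inf_iff inf.bounded_iff\<close>)
    qed
    finally show "?l * ?r \<le> (SUP q\<in>obj (prod_vcat X' Y'). \<chi> p q)" .
  qed
  ultimately show "?l * ?r \<le> GH_mod (prod_vcat X Y) (prod_vcat X' Y')"
    using hausdorff_ext_le_GH_mod order_trans by blast
qed

lemma is_vmodule_hausdorff_ext:
  assumes "is_vmodule X Y \<phi>"
  shows "is_vmodule (hausdorff_vcat X) (hausdorff_vcat Y) (hausdorff_ext \<phi>)"
  using assms unfolding is_vmodule_def[of "hausdorff_vcat X"]
  by (auto simp: hausdorff_vcat_def intro!: hausdorff_ext_mult_le)
    (auto simp: is_vmodule_def subset_iff)

lemma GH_mod_hausdorff: "GH_mod X Y \<le> GH_mod (hausdorff_vcat X) (hausdorff_vcat Y)"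
proof (rule GH_mod_least)
  fix \<phi> assume \<phi>: "is_vmodule X Y \<phi>"
  have "hausdorff_ext \<phi> (obj X) (obj Y)
      \<le> hausdorff_ext (hausdorff_ext \<phi>) (obj (hausdorff_vcat X)) (obj (hausdorff_vcat Y))"
  proof (rule hausdorff_ext_greatest)
    fix A assume "A \<in> obj (hausdorff_vcat X)"
    \<comment> \<open>the partner of \<open>A\<close> is the whole of \<open>Y\<close>\<close>
    then have "hausdorff_ext \<phi> (obj X) (obj Y) \<le> hausdorff_ext \<phi> A (obj Y)"
      by (intro hausdorff_ext_greatest hausdorff_ext_lower) (auto simp: hausdorff_vcat_def)
    then show "hausdorff_ext \<phi> (obj X) (obj Y) \<le> (SUP B\<in>obj (hausdorff_vcat Y). hausdorff_ext \<phi> A B)"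
      by (intro SUP_upper2[of "obj Y"]) (auto simp: hausdorff_vcat_def)
  qed
  also have "\<dots> \<le> GH_mod (hausdorff_vcat X) (hausdorff_vcat Y)"
    using \<phi> by (intro hausdorff_ext_le_GH_mod is_vmodule_hausdorff_ext)
  finally show "hausdorff_ext \<phi> (obj X) (obj Y) \<le> GH_mod (hausdorff_vcat X) (hausdorff_vcat Y)" .
qed

section \<open>The two monoids and the homomorphism\<close>

lemma is_vcat_GH: "is_vcat (GH :: (('u::set_universe, 'v::comm_unital_quantale) vcat set, 'v) vcat)"
  unfolding is_vcat_def
  by (auto elim!: GH_objE simp: hom_GH_ess_small GH_mod_triangle)
    (simp add: ess_small_vcat_def one_le_GH_mod)

lemma is_vcat_monoid_GH_plus:
  assumes "(1 :: 'v::comm_unital_quantale) = top"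
  shows "is_vcat_monoid (GH :: (('u::set_universe, 'v) vcat set, 'v) vcat) GH_plus GH_zero"
  unfolding is_vcat_monoid_def
proof (intro conjI ballI)
  let ?GH = "GH :: (('u, 'v) vcat set, 'v) vcat"
  note ess = ess_small_vcat_coprod ess_small_vcat_empty
  show "is_vcat ?GH"
    by (rule is_vcat_GH)
  show "is_vfunctor (tensor_vcat ?GH ?GH) ?GH GH_plus"
    by (auto simp: is_vfunctor_def tensor_vcat_def ess hom_GH_ess_small GH_plus_ess_small
      GH_mod_coprod[OF assms] elim!: GH_objE intro!: iso_class_in_GH)
  show "is_vfunctor unit_vcat ?GH GH_zero"
    by (auto simp: is_vfunctor_def unit_vcat_def GH_zero_def ess hom_GH_ess_small
      one_le_GH_mod is_vcat_empty intro!: iso_class_in_GH)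
  fix C assume "C \<in> obj ?GH"
  then obtain X :: "('u, 'v) vcat" where X: "ess_small_vcat TYPE('u) X" "C = iso_class X"
    by (rule GH_objE)
  show "GH_plus (GH_zero (), C) = C"
    by (simp add: GH_zero_def X GH_plus_ess_small ess iso_class_cong[OF coprod_vcat_empty_left])
  show "GH_plus (C, GH_zero ()) = C"
    by (simp add: GH_zero_def X GH_plus_ess_small ess iso_class_cong[OF coprod_vcat_empty_right])
  fix D E assume D: "D \<in> obj ?GH" and E: "E \<in> obj ?GH"
  obtain Y :: "('u, 'v) vcat" where Y: "ess_small_vcat TYPE('u) Y" "D = iso_class Y"
    using D by (rule GH_objE)
  obtain Z :: "('u, 'v) vcat" where Z: "ess_small_vcat TYPE('u) Z" "E = iso_class Z"
    using E by (rule GH_objE)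
  show "GH_plus (GH_plus (C, D), E) = GH_plus (C, GH_plus (D, E))"
    by (simp add: X Y Z GH_plus_ess_small ess iso_class_cong[OF coprod_vcat_assoc])
qed

lemma is_vcat_monoid_GH_times:
  assumes "(1 :: 'v::comm_unital_quantale) = top"
  shows "is_vcat_monoid (GH :: (('u::set_universe, 'v) vcat set, 'v) vcat) GH_times GH_one"
  unfolding is_vcat_monoid_def
proof (intro conjI ballI)
  let ?GH = "GH :: (('u, 'v) vcat set, 'v) vcat"
  note ess = ess_small_vcat_prod ess_small_vcat_terminal
  show "is_vcat ?GH"
    by (rule is_vcat_GH)
  show "is_vfunctor (tensor_vcat ?GH ?GH) ?GH GH_times"
    by (auto simp: is_vfunctor_def tensor_vcat_def ess hom_GH_ess_small GH_times_ess_small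
      GH_mod_prod[OF assms] elim!: GH_objE intro!: iso_class_in_GH)
  show "is_vfunctor unit_vcat ?GH GH_one"
    by (auto simp: is_vfunctor_def unit_vcat_def GH_one_def ess hom_GH_ess_small
      one_le_GH_mod is_vcat_terminal intro!: iso_class_in_GH)
  fix C assume "C \<in> obj ?GH"
  then obtain X :: "('u, 'v) vcat" where X: "ess_small_vcat TYPE('u) X" "C = iso_class X"
    by (rule GH_objE)
  show "GH_times (GH_one (), C) = C"
    by (simp add: GH_one_def X GH_times_ess_small ess iso_class_cong[OF prod_vcat_terminal_left])
  show "GH_times (C, GH_one ()) = C"
    by (simp add: GH_one_def X GH_times_ess_small ess iso_class_cong[OF prod_vcat_terminal_right])
  fix D E assume D: "D \<in> obj ?GH" and E: "E \<in> obj ?GH"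
  obtain Y :: "('u, 'v) vcat" where Y: "ess_small_vcat TYPE('u) Y" "D = iso_class Y"
    using D by (rule GH_objE)
  obtain Z :: "('u, 'v) vcat" where Z: "ess_small_vcat TYPE('u) Z" "E = iso_class Z"
    using E by (rule GH_objE)
  show "GH_times (GH_times (C, D), E) = GH_times (C, GH_times (D, E))"
    by (simp add: X Y Z GH_times_ess_small ess iso_class_cong[OF prod_vcat_assoc])
qed

lemma is_vfunctor_GH_hausdorff:
  "is_vfunctor (GH :: (('u::set_universe, 'v::comm_unital_quantale) vcat set, 'v) vcat) GH GH_hausdorff"
  by (auto simp: is_vfunctor_def hom_GH_ess_small GH_hausdorff_ess_small ess_small_vcat_hausdorff
    GH_mod_hausdorff elim!: GH_objE intro!: iso_class_in_GH)

theorem theorem6: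
  assumes "(1 :: 'v::comm_unital_quantale) = top"
  shows "(\<forall>X :: ('u::set_universe, 'v) vcat.
            small_vcat X \<longrightarrow> GH_hausdorff (iso_class X :: ('u, 'v) vcat set) = iso_class (hausdorff_vcat X)) \<and>
         is_vcat_monoid_hom
           (GH :: (('u, 'v) vcat set, 'v) vcat) GH_plus GH_zero
           (GH :: (('u, 'v) vcat set, 'v) vcat) GH_times GH_one
           GH_hausdorff"
  unfolding is_vcat_monoid_hom_def
proof (intro conjI allI ballI impI)
  note ess = ess_small_vcat_coprod ess_small_vcat_hausdorff ess_small_vcat_empty
  show "GH_hausdorff (iso_class X :: ('u, 'v) vcat set) = iso_class (hausdorff_vcat X)"
    if "small_vcat X" for X :: "('u, 'v) vcat"
    using that by (rule GH_hausdorff_iso_class)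
  show "GH_hausdorff (GH_plus (C, D)) = GH_times (GH_hausdorff C, GH_hausdorff D)"
    if "C \<in> obj GH" "D \<in> obj GH" for C D :: "('u, 'v) vcat set"
  proof -
    obtain X :: "('u, 'v) vcat" where X: "ess_small_vcat TYPE('u) X" "C = iso_class X"
      using \<open>C \<in> obj GH\<close> by (rule GH_objE)
    obtain Y :: "('u, 'v) vcat" where Y: "ess_small_vcat TYPE('u) Y" "D = iso_class Y"
      using \<open>D \<in> obj GH\<close> by (rule GH_objE)
    show ?thesis
      by (simp add: X Y GH_plus_ess_small GH_hausdorff_ess_small GH_times_ess_small ess
        iso_class_cong[OF hausdorff_vcat_coprod])
  qed
  show "GH_hausdorff (GH_zero ()) = (GH_one () :: ('u, 'v) vcat set)"
    by (simp add: GH_zero_def GH_one_def GH_hausdorff_ess_small ess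
      iso_class_cong[OF hausdorff_vcat_empty])
qed (use assms in \<open>simp_all add: is_vcat_monoid_GH_plus is_vcat_monoid_GH_times
      is_vfunctor_GH_hausdorff\<close>)

end
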